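(* Let $(V,E,\mu)$ be an infinite, connected, locally finite weighted graph and let $q>1$. If for some $o\in V$ $$\sum_{n=1}^\infty \frac{n^{2q-1}}{\mu(B(o,n))^{q-1}}=\infty,$$ then every nonnegative function $u$ on $V$ satisfying $-\Delta u\ge u^q$ in $V$ is identically zero.
   Context: Weighted graph: $\mu_{xy}=\mu_{yx}\ge0$, $\mu_{xy}>0$ iff $x\sim y$, $\mu(x)=\sum_{y\sim x}\mu_{xy}$, and for $A\subset V$, $\mu(A)=\sum_{x\in A}\mu(x)$. The Laplacian is $\Delta u(x)=\frac{1}{\mu(x)}\sum_{y\sim x}\mu_{xy}(u(y)-u(x))$. $d(x,y)$ is the graph distance (minimal number of edges of a path from $x$ to $y$) and $B(o,r)=\{x\in V: d(o,x)\le r\}$. No volume doubling, Poincaré or ellipticity assumptions are made. *)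

theory Defs
  imports "HOL-Analysis.Analysis"
begin

text \<open>Weighted graph on the vertex type 'v, given by edge weights w x y = mu_xy.
  Adjacency: x ~ y iff w x y > 0.\<close>

definition weighted_graph :: "('v \<Rightarrow> 'v \<Rightarrow> real) \<Rightarrow> bool" where
  "weighted_graph w \<longleftrightarrow> (\<forall>x y. w x y = w y x \<and> w x y \<ge> 0)"

definition adj :: "('v \<Rightarrow> 'v \<Rightarrow> real) \<Rightarrow> 'v \<Rightarrow> 'v \<Rightarrow> bool" where
  "adj w x y \<longleftrightarrow> w x y > 0"

definition edges :: "('v \<Rightarrow> 'v \<Rightarrow> real) \<Rightarrow> ('v \<times> 'v) set" where
  "edges w = {(x, y). adj w x y}"

definition locally_finite :: "('v \<Rightarrow> 'v \<Rightarrow> real) \<Rightarrow> bool" where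
  "locally_finite w \<longleftrightarrow> (\<forall>x. finite {y. adj w x y})"

definition connected_graph :: "('v \<Rightarrow> 'v \<Rightarrow> real) \<Rightarrow> bool" where
  "connected_graph w \<longleftrightarrow> (\<forall>x y. (x, y) \<in> (edges w)\<^sup>*)"

text \<open>Vertex measure mu(x) = sum of weights of edges at x.\<close>
definition vmeas :: "('v \<Rightarrow> 'v \<Rightarrow> real) \<Rightarrow> 'v \<Rightarrow> real" where
  "vmeas w x = (\<Sum>y\<in>{y. adj w x y}. w x y)"

definition set_meas :: "('v \<Rightarrow> 'v \<Rightarrow> real) \<Rightarrow> 'v set \<Rightarrow> real" where
  "set_meas w A = (\<Sum>x\<in>A. vmeas w x)"

text \<open>Graph distance: minimal number of edges of a path from x to y.\<close>
definition gdist :: "('v \<Rightarrow> 'v \<Rightarrow> real) \<Rightarrow> 'v \<Rightarrow> 'v \<Rightarrow> nat" where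
  "gdist w x y = (LEAST n. (x, y) \<in> (edges w) ^^ n)"

definition gball :: "('v \<Rightarrow> 'v \<Rightarrow> real) \<Rightarrow> 'v \<Rightarrow> nat \<Rightarrow> 'v set" where
  "gball w x0 r = {x. gdist w x0 x \<le> r}"

definition laplacian :: "('v \<Rightarrow> 'v \<Rightarrow> real) \<Rightarrow> ('v \<Rightarrow> real) \<Rightarrow> 'v \<Rightarrow> real" where
  "laplacian w u x = (1 / vmeas w x) * (\<Sum>y\<in>{y. adj w x y}. w x y * (u y - u x))"

end

theory Submission
  imports Defs
begin

text \<open>
Let \<open>\<phi>\<close> be the radial cutoff that is \<open>1\<close> on \<open>B(r)\<close> and vanishes outside \<open>B(2r)\<close>, and put
\<open>v = u/\<rho>\<close> for a scale \<open>\<rho> > 0\<close>. Testing \<open>-\<Delta>u \<ge> u\<^sup>q\<close> against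
\<open>\<phi>\<^sup>m (1 + (1 + v)\<^bsup>-t\<^esup>)\<close> with \<open>1 + t < q\<close>, the bounded decreasing factor produces a negative
gradient term which absorbs the cross term edge by edge. The sign of \<open>(u x - u y)(\<phi> x - \<phi> y)\<close>
decides which edges matter, and on those the larger value of \<open>u\<close> sits at the endpoint with the larger
value of \<open>\<phi>\<close>; this is why no ellipticity is needed. With \<open>N = \<Sum> u\<^sup>q \<phi>\<^sup>m \<mu>\<close> and \<open>M(r)\<close> the
\<open>u\<^sup>q\<mu>\<close>-mass of \<open>B(r - 1)\<close> one gets
\<open>N \<le> C \<rho> r\<^bsup>-2\<^esup> (\<mu>(B(2r)) + \<rho>\<^bsup>-q\<^esup> (N - M(r)))\<close>. Optimising in \<open>\<rho>\<close>,
\<open>r\<^bsup>2q\<^esup> / \<mu>(B(2r))\<^bsup>q-1\<^esup> \<le> C (N - M(r)) / N\<^sup>q \<le> C' (M(r)\<^bsup>1-q\<^esup> - M(2r)\<^bsup>1-q\<^esup>)\<close>,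
because \<open>M(r) \<le> N \<le> M(2r)\<close> and \<open>x\<^bsup>-q\<^esup>\<close> is decreasing. The right-hand side telescopes along
\<open>r = 2\<^sup>k\<close>, so the series converges unless \<open>u = 0\<close>.
\<close>

section \<open>Pointwise inequalities\<close>

text \<open>Convexity of a negative power: its graph lies above the tangent at the larger point
  \<open>a\<close>. This serves twice, for the damping factor and for turning a mass difference into
  a telescoping one.\<close>

lemma powr_neg_tangent:
  fixes a b t :: real
  assumes "0 < b" "b \<le> a" "0 < t"
  shows "t * a powr (- t - 1) * (a - b) \<le> b powr (- t) - a powr (- t)"
proof (cases "b = a")
  case False
  with assms have "b < a" by simp
  have "\<exists>z. b < z \<and> z < a \<and> a powr (- t) - b powr (- t) = (a - b) * (- t * z powr (- t - 1))"
    using assms by (intro MVT2[OF \<open>b < a\<close>]) (auto intro!: derivative_eq_intros)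
  then obtain z where z: "b < z" "z < a"
    and eq: "a powr (- t) - b powr (- t) = (a - b) * (- t * z powr (- t - 1))"
    by blast
  have "a powr (- t - 1) \<le> z powr (- t - 1)"
    using z assms by (intro powr_mono2') auto
  then have "(a - b) * (t * a powr (- t - 1)) \<le> (a - b) * (t * z powr (- t - 1))"
    using assms by (intro mult_left_mono) auto
  with eq show ?thesis by (simp add: algebra_simps)
qed simp

lemma power_diff_le:
  fixes a b :: real
  assumes "0 \<le> b" "b \<le> a"
  shows "a ^ Suc n - b ^ Suc n \<le> real (Suc n) * a ^ n * (a - b)"
proof (induction n)
  case (Suc n)
  have "a ^ Suc (Suc n) - b ^ Suc (Suc n) = a * (a ^ Suc n - b ^ Suc n) + b ^ Suc n * (a - b)"
    by (simp add: algebra_simps)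
  also have "\<dots> \<le> a * (real (Suc n) * a ^ n * (a - b)) + a ^ Suc n * (a - b)"
    using assms Suc by (intro add_mono mult_left_mono mult_right_mono power_mono) auto
  also have "\<dots> = real (Suc (Suc n)) * a ^ Suc n * (a - b)"
    by (simp add: algebra_simps)
  finally show ?case .
qed simp

text \<open>The summand \<open>1\<close> keeps the test function from degenerating where
  \<open>a\<close> is large; the shift \<open>1 + a\<close> keeps the negative power bounded near
  \<open>a = 0\<close>.\<close>

definition damp :: "real \<Rightarrow> real \<Rightarrow> real" where
  "damp t a = 1 + (1 + a) powr (- t)"

lemma damp_bounds:
  assumes "0 \<le> a" "0 < t"
  shows "1 \<le> damp t a" "damp t a \<le> 2"
  using assms powr_mono2'[of "-t" 1 "1 + a"] by (auto simp: damp_def)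

lemma damp_diff:
  assumes "0 \<le> b" "b \<le> a" "0 < t"
  shows "t * (a - b) / (1 + a) powr (1 + t) \<le> damp t b - damp t a"
proof -
  have "(1 + a) powr (- t - 1) = 1 / (1 + a) powr (1 + t)"
    by (metis minus_add_distrib powr_minus_divide uminus_add_conv_diff add.commute)
  with powr_neg_tangent[of "1 + b" "1 + a" t] assms show ?thesis
    by (simp add: damp_def)
qed

text \<open>The summand \<open>2\<close> pays for edges on which the cutoff drops to 0, the quotient
  for completing the square on the others.\<close>

definition edge_const :: "nat \<Rightarrow> real \<Rightarrow> real" where
  "edge_const p t = 2 + real (p + 2) ^ 2 * 2 ^ (p + 2) / t"

lemma edge_const_pos: "0 < t \<Longrightarrow> 0 < edge_const p t"
  by (simp add: edge_const_def add_pos_nonneg)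

text \<open>If the cutoff does not drop from the endpoint with value \<open>a\<close>, the product
  is nonpositive by monotonicity. If it drops to 0, a crude bound suffices. Otherwise the decrease
  of \<open>damp\<close> gives a negative multiple of \<open>(a - b)^2\<close> that absorbs the
  cross term. Completing the square costs two powers of \<phi>, so exponent \<open>p + 2\<close>
  leaves \<open>\<phi> ^ p\<close>.\<close>

lemma edge_estimate:
  fixes a b \<phi> \<theta> t :: real and p :: nat
  assumes ab: "0 \<le> b" "b \<le> a" and t: "0 < t"
    and nonneg: "0 \<le> \<phi>" "0 \<le> \<theta>"
    and drop: "\<theta> < \<phi> \<Longrightarrow> \<theta> = 0 \<or> \<phi> \<le> 2 * \<theta>"
  shows "(a - b) * (\<phi> ^ (p + 2) * damp t a - \<theta> ^ (p + 2) * damp t b)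
    \<le> (if \<theta> < \<phi> then edge_const p t * (\<phi> - \<theta>)\<^sup>2 * \<phi> ^ p * (1 + a) powr (1 + t) else 0)"
proof -
  define K where "K = edge_const p t"
  have a0: "0 \<le> a" using ab by simp
  note da = damp_bounds[OF a0 t]
  have dd: "t * (a - b) / (1 + a) powr (1 + t) \<le> damp t b - damp t a"
    using damp_diff ab t by blast
  then have dec: "damp t a \<le> damp t b"
    using ab t by (smt (verit) divide_nonneg_nonneg mult_nonneg_nonneg powr_ge_zero)
  define Z where "Z = (1 + a) powr (1 + t)"
  have aZ: "a \<le> Z" and Z1: "1 \<le> Z"
  proof -
    have "(1 + a) powr 1 \<le> Z" unfolding Z_def using a0 t by (intro powr_mono) auto
    then show "a \<le> Z" "1 \<le> Z" using a0 by auto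
  qed
  have K2: "2 \<le> K" and Kt: "real (p + 2) ^ 2 * 2 ^ (p + 2) / t \<le> K"
    using t by (auto simp: K_def edge_const_def)
  consider "\<phi> \<le> \<theta>" | "\<theta> < \<phi>" "\<theta> = 0" | "\<theta> < \<phi>" "\<phi> \<le> 2 * \<theta>" using drop by fastforce
  then show ?thesis
  proof cases
    case 1
    have "\<phi> ^ (p + 2) * damp t a \<le> \<theta> ^ (p + 2) * damp t b"
      using 1 nonneg dec da by (intro mult_mono power_mono) auto
    then have "(a - b) * (\<phi> ^ (p + 2) * damp t a - \<theta> ^ (p + 2) * damp t b) \<le> 0"
      using ab by (intro mult_nonneg_nonpos) auto
    then show ?thesis using 1 by simp
  next
    case 2
    have "(a - b) * (\<phi> ^ (p + 2) * damp t a - \<theta> ^ (p + 2) * damp t b)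
        = (a - b) * damp t a * \<phi> ^ (p + 2)"
      using 2 by simp
    also have "\<dots> \<le> Z * K * \<phi> ^ (p + 2)"
      using ab aZ da K2 nonneg by (intro mult_right_mono mult_mono) auto
    also have "\<dots> = K * (\<phi> - \<theta>)\<^sup>2 * \<phi> ^ p * Z"
      using 2 by (simp add: power_add power2_eq_square)
    finally show ?thesis using 2 by (simp add: Z_def K_def)
  next
    case 3
    define m where "m = real (p + 2)"
    define c where "c = t / 2 ^ (p + 2)"
    have c0: "0 < c" using t by (simp add: c_def)
    have Kc: "m\<^sup>2 / c \<le> K" using Kt by (simp add: m_def c_def)
    have e1: "(\<phi> ^ (p + 2) - \<theta> ^ (p + 2)) * damp t a \<le> (m * \<phi> ^ (p + 1) * (\<phi> - \<theta>)) * 2"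
      using power_diff_le[of \<theta> \<phi> "p + 1"] 3 nonneg da
      by (intro mult_mono) (auto simp: m_def)
    \<comment> \<open>Comparability of \<theta> and \<phi> lets the negative term carry the weight
      of the larger cutoff value, as the cross term does.\<close>
    have "\<phi> ^ (p + 2) \<le> (2 * \<theta>) ^ (p + 2)"
      using 3 nonneg by (intro power_mono) auto
    then have "\<phi> ^ (p + 2) / 2 ^ (p + 2) \<le> \<theta> ^ (p + 2)"
      by (simp add: power_mult_distrib field_simps)
    then have e2: "\<phi> ^ (p + 2) / 2 ^ (p + 2) * (t * (a - b) / Z) \<le> \<theta> ^ (p + 2) * (damp t b - damp t a)"
      using dd ab t nonneg Z1 unfolding Z_def[symmetric] by (intro mult_mono) auto
    have "\<phi> ^ (p + 2) * damp t a - \<theta> ^ (p + 2) * damp t b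
        = (\<phi> ^ (p + 2) - \<theta> ^ (p + 2)) * damp t a - \<theta> ^ (p + 2) * (damp t b - damp t a)"
      by (simp add: algebra_simps)
    also have "\<dots> \<le> (m * \<phi> ^ (p + 1) * (\<phi> - \<theta>)) * 2 - \<phi> ^ (p + 2) / 2 ^ (p + 2) * (t * (a - b) / Z)"
      using e1 e2 by linarith
    finally have "(a - b) * (\<phi> ^ (p + 2) * damp t a - \<theta> ^ (p + 2) * damp t b) \<le>
        (a - b) * ((m * \<phi> ^ (p + 1) * (\<phi> - \<theta>)) * 2 - \<phi> ^ (p + 2) / 2 ^ (p + 2) * (t * (a - b) / Z))"
      using ab by (intro mult_left_mono) auto
    \<comment> \<open>complete the square in \<open>a - b\<close>\<close>
    also have "\<dots> = m\<^sup>2 / c * (\<phi> - \<theta>)\<^sup>2 * \<phi> ^ p * Z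
        - \<phi> ^ p / (c * Z) * (c * \<phi> * (a - b) - m * (\<phi> - \<theta>) * Z)\<^sup>2"
    proof -
      have "\<phi> ^ (p + 2) / 2 ^ (p + 2) * (t * (a - b) / Z) = c * \<phi> ^ (p + 2) * (a - b) / Z"
        by (simp add: c_def)
      moreover have "(a - b) * ((m * \<phi> ^ (p + 1) * (\<phi> - \<theta>)) * 2 - c * \<phi> ^ (p + 2) * (a - b) / Z)
        = m\<^sup>2 / c * (\<phi> - \<theta>)\<^sup>2 * \<phi> ^ p * Z
        - \<phi> ^ p / (c * Z) * (c * \<phi> * (a - b) - m * (\<phi> - \<theta>) * Z)\<^sup>2"
        using c0 Z1 by (simp add: power_add divide_simps) algebra
      ultimately show ?thesis by simp
    qed
    also have "\<dots> \<le> m\<^sup>2 / c * (\<phi> - \<theta>)\<^sup>2 * \<phi> ^ p * Z"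
      using c0 Z1 nonneg by auto
    also have "\<dots> \<le> K * (\<phi> - \<theta>)\<^sup>2 * \<phi> ^ p * Z"
      using Kc Z1 nonneg by (intro mult_right_mono) auto
    finally show ?thesis using 3 by (simp add: Z_def K_def)
  qed
qed

text \<open>As \<phi> is at most 1, the exponent condition bounds
  \<open>\<phi> ^ p * a powr s\<close> by \<open>y powr (s / q)\<close> with
  \<open>y = \<phi> ^ (p + 2) * a powr q\<close>, and this is at most \<open>1 + y\<close>. The two
  summands later become volume and mass.\<close>

lemma weighted_interpolation:
  fixes \<phi> a s q :: real and p :: nat
  assumes "0 \<le> \<phi>" "\<phi> \<le> 1" "0 \<le> a" "0 < s" "s < q" "real (p + 2) * s \<le> real p * q"
  shows "\<phi> ^ p * (1 + a) powr s \<le> 2 powr s * (1 + \<phi> ^ (p + 2) * a powr q)"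
proof -
  define y where "y = \<phi> ^ (p + 2) * a powr q"
  have y0: "0 \<le> y" using assms by (simp add: y_def)
  \<comment> \<open>For \<open>p = 0\<close> the exponent condition would read
    \<open>2 * s \<le> 0\<close>. Positivity makes \<open>\<phi> ^ p\<close> vanish where \<phi>
    does.\<close>
  have "0 < p" using assms by (cases p) (auto simp: mult_le_0_iff)
  have "\<phi> ^ p * a powr s \<le> 1 + y"
  proof (cases "\<phi> = 0")
    case True
    then show ?thesis using \<open>0 < p\<close> y0 by (simp add: zero_power)
  next
    case False
    then have \<phi>: "0 < \<phi>" using assms by simp
    have "\<phi> ^ p = \<phi> powr real p" using \<phi> by (simp add: powr_realpow)
    also have "\<dots> \<le> \<phi> powr (real (p + 2) * (s / q))"
      using assms \<phi> by (intro powr_mono') (auto simp: field_simps)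
    also have "\<dots> = (\<phi> ^ (p + 2)) powr (s / q)"
      using \<phi> by (metis powr_powr powr_realpow)
    finally have "\<phi> ^ p * a powr s \<le> (\<phi> ^ (p + 2)) powr (s / q) * (a powr q) powr (s / q)"
      using assms by (intro mult_mono) (auto simp: powr_powr)
    also have "\<dots> = y powr (s / q)"
      using assms by (simp add: y_def powr_mult)
    also have "\<dots> \<le> 1 + y"
    proof (cases "y \<le> 1")
      case True
      then have "y powr (s / q) \<le> 1" using assms y0 by (intro powr_le1) auto
      then show ?thesis using y0 by simp
    next
      case False
      then have "y powr (s / q) \<le> y powr 1" using assms by (intro powr_mono) auto
      then show ?thesis using False by simp
    qed
    finally show ?thesis .
  qed
  moreover have "\<phi> ^ p \<le> 1" using assms by (simp add: power_le_one)
  ultimately have "\<phi> ^ p * max 1 (a powr s) \<le> 1 + y" using y0 by (auto simp: max_def)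
  moreover have "(1 + a) powr s \<le> 2 powr s * max 1 (a powr s)"
  proof -
    have "(1 + a) powr s \<le> (2 * max 1 a) powr s"
      using assms by (intro powr_mono2) auto
    also have "\<dots> = 2 powr s * max 1 a powr s" using assms by (simp add: powr_mult)
    also have "max 1 a powr s \<le> max 1 (a powr s)" by (auto simp: max_def)
    finally show ?thesis by simp
  qed
  then have "\<phi> ^ p * (1 + a) powr s \<le> \<phi> ^ p * (2 powr s * max 1 (a powr s))"
    using assms by (intro mult_left_mono) auto
  ultimately show ?thesis unfolding y_def
    by (smt (verit, best) mult.left_commute mult_left_mono powr_ge_zero)
qed

text \<open>After half of \<open>N\<close> is absorbed, the bound says that the left-hand side is at
  most \<open>N powr (- q) * (N - M)\<close>. Up to the factor \<open>q - 1\<close> this is the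
  tangent estimate for the power \<open>1 - q\<close> at \<open>N\<close>.\<close>

lemma optimise_scale:
  fixes N M V R C q :: real
  assumes pos: "0 < M" "M \<le> N" "0 < V" "0 < R" "0 < C" and q: "1 < q"
    and bound: "\<And>\<rho>. 0 < \<rho> \<Longrightarrow> N \<le> \<rho> * (C / R) * (V + \<rho> powr (- q) * (N - M))"
  shows "(R / (2 * C)) powr q * V powr (1 - q) \<le> (M powr (1 - q) - N powr (1 - q)) / (q - 1)"
proof -
  have N0: "0 < N" using pos by simp
  define X where "X = R / (2 * C)"
  have X0: "0 < X" using pos by (simp add: X_def)
  \<comment> \<open>this scale makes the volume term of the bound equal to \<open>N / 2\<close>\<close>
  define \<rho> where "\<rho> = N * X / V"
  have \<rho>0: "0 < \<rho>" using N0 X0 pos by (simp add: \<rho>_def)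
  have CR: "C / R = 1 / (2 * X)" using pos by (simp add: X_def)
  have "N \<le> \<rho> * (1 / (2 * X)) * V + \<rho> * (1 / (2 * X)) * \<rho> powr (- q) * (N - M)"
    using bound[OF \<rho>0] unfolding CR by (simp only: distrib_left mult.assoc)
  moreover have "\<rho> * (1 / (2 * X)) * V = N / 2"
    using X0 pos by (simp add: \<rho>_def)
  ultimately have "N * X \<le> \<rho> powr (- q) * (N - M) * \<rho>"
    using X0 by (simp add: field_simps)
  moreover have "N * X = V * \<rho>" using pos by (simp add: \<rho>_def)
  ultimately have "V \<le> \<rho> powr (- q) * (N - M)"
    using \<rho>0 by (simp only: mult_le_cancel_right_pos)
  then have "\<rho> powr q * V \<le> N - M"
    using \<rho>0 by (simp add: powr_minus field_simps)
  moreover have "\<rho> powr q * V = N powr q * (X powr q * V powr (1 - q))"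
    using N0 X0 pos by (simp add: \<rho>_def powr_divide powr_mult powr_diff)
  ultimately have "X powr q * V powr (1 - q) \<le> N powr (- q) * (N - M)"
    using N0 by (simp add: powr_minus field_simps)
  moreover have "(q - 1) * N powr (- q) * (N - M) \<le> M powr (1 - q) - N powr (1 - q)"
    using powr_neg_tangent[of M N "q - 1"] pos q by simp
  ultimately show ?thesis
    using q by (simp add: X_def pos_le_divide_eq) (smt (verit) mult.commute mult.assoc mult_left_mono)
qed

section \<open>Balls, Green's formula and the radial cutoff\<close>

lemma gdist_path:
  assumes "connected_graph w"
  shows "(x, y) \<in> edges w ^^ gdist w x y"
  using assms unfolding connected_graph_def gdist_def
  by (metis LeastI_ex rtrancl_imp_relpow)

lemma gdist_adj_le:
  assumes "connected_graph w" "adj w x y"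
  shows "gdist w z y \<le> Suc (gdist w z x)"
proof -
  have "(z, y) \<in> edges w ^^ Suc (gdist w z x)"
    using gdist_path[OF assms(1)] assms(2) by (auto simp: edges_def)
  then show ?thesis unfolding gdist_def[of w z y] by (rule Least_le)
qed

lemma finite_gball:
  assumes "connected_graph w" "locally_finite w"
  shows "finite (gball w x n)"
proof -
  have fin: "finite {y. (x, y) \<in> edges w ^^ k}" for k
  proof (induction k)
    case (Suc k)
    have "{y. (x, y) \<in> edges w ^^ Suc k} = (\<Union>z\<in>{z. (x, z) \<in> edges w ^^ k}. {y. adj w z y})"
      by (auto simp: edges_def)
    then show ?case using Suc assms(2) by (auto simp: locally_finite_def)
  qed simp
  have "gball w x n \<subseteq> (\<Union>k\<le>n. {y. (x, y) \<in> edges w ^^ k})"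
    using gdist_path[OF assms(1)] by (auto simp: gball_def)
  then show ?thesis by (rule finite_subset) (use fin in auto)
qed

lemma vmeas_nonneg: "weighted_graph w \<Longrightarrow> 0 \<le> vmeas w x"
  by (simp add: vmeas_def weighted_graph_def sum_nonneg)

lemma set_meas_mono:
  assumes "weighted_graph w" "finite B" "A \<subseteq> B"
  shows "set_meas w A \<le> set_meas w B"
  unfolding set_meas_def using assms vmeas_nonneg[OF assms(1)] by (intro sum_mono2) auto

text \<open>Non-neighbours have weight 0 and neighbours outside \<open>S\<close> are merely lost, so
  double sums truncated to a finite ball are still controlled by the vertex measure.\<close>

lemma sum_weight_le_vmeas:
  assumes "weighted_graph w" "locally_finite w" "finite S"
  shows "(\<Sum>y\<in>S. w x y) \<le> vmeas w x"
proof -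
  have "(\<Sum>y\<in>S. w x y) = (\<Sum>y\<in>S \<inter> {y. adj w x y}. w x y)"
    using assms by (intro sum.mono_neutral_right)
      (auto simp: adj_def weighted_graph_def order.antisym not_less)
  also have "\<dots> \<le> vmeas w x"
    unfolding vmeas_def using assms
    by (intro sum_mono2) (auto simp: locally_finite_def weighted_graph_def)
  finally show ?thesis .
qed

lemma vmeas_mult_laplacian:
  assumes "weighted_graph w" "locally_finite w" "finite S" "{y. adj w x y} \<subseteq> S"
  shows "vmeas w x * - laplacian w u x = (\<Sum>y\<in>S. w x y * (u x - u y))"
proof -
  have fin: "finite {y. adj w x y}" using assms by (simp add: locally_finite_def)
  have "vmeas w x * - laplacian w u x = - (\<Sum>y\<in>{y. adj w x y}. w x y * (u y - u x))"
  proof (cases "vmeas w x = 0")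
    \<comment> \<open>Here the factor \<open>1 / vmeas w x\<close> is 0 by the division convention;
      all weights at \<open>x\<close> vanish too, so both sides are 0.\<close>
    case True
    then have "w x y = 0" if "adj w x y" for y
      using that fin assms(1) by (auto simp: vmeas_def weighted_graph_def sum_nonneg_eq_0_iff)
    then have "(\<Sum>y\<in>{y. adj w x y}. w x y * (u y - u x)) = 0"
      by (intro sum.neutral) auto
    with True show ?thesis by simp
  qed (simp add: laplacian_def)
  also have "\<dots> = (\<Sum>y\<in>{y. adj w x y}. w x y * (u x - u y))"
    by (simp add: sum_negf[symmetric] algebra_simps)
  also have "\<dots> = (\<Sum>y\<in>S. w x y * (u x - u y))"
    using assms by (intro sum.mono_neutral_left)
      (auto simp: adj_def weighted_graph_def order.antisym not_less)
  finally show ?thesis .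
qed

text \<open>By symmetry of the weights, the left-hand sum equals its transpose; adding the two gives
  the result. No boundary term arises because both indices run over the same set.\<close>

lemma green_formula:
  fixes w :: "'v \<Rightarrow> 'v \<Rightarrow> real"
  assumes "weighted_graph w"
  shows "2 * (\<Sum>x\<in>S. \<psi> x * (\<Sum>y\<in>S. w x y * (u x - u y)))
    = (\<Sum>x\<in>S. \<Sum>y\<in>S. w x y * ((u x - u y) * (\<psi> x - \<psi> y)))"
proof -
  have sym: "w x y = w y x" for x y using assms by (simp add: weighted_graph_def)
  have 1: "(\<Sum>x\<in>S. \<psi> x * (\<Sum>y\<in>S. w x y * (u x - u y)))
      = (\<Sum>x\<in>S. \<Sum>y\<in>S. w x y * (u x - u y) * \<psi> x)"
    by (simp add: sum_distrib_left mult.commute)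
  have 2: "\<dots> = (\<Sum>x\<in>S. \<Sum>y\<in>S. w x y * (u y - u x) * \<psi> y)"
    by (subst sum.swap) (simp add: sym)
  have "(\<Sum>x\<in>S. \<Sum>y\<in>S. w x y * ((u x - u y) * (\<psi> x - \<psi> y)))
    = (\<Sum>x\<in>S. \<Sum>y\<in>S. w x y * (u x - u y) * \<psi> x + w x y * (u y - u x) * \<psi> y)"
    by (intro sum.cong refl) (simp add: algebra_simps)
  also have "\<dots> = (\<Sum>x\<in>S. \<Sum>y\<in>S. w x y * (u x - u y) * \<psi> x) + (\<Sum>x\<in>S. \<Sum>y\<in>S. w x y * (u y - u x) * \<psi> y)"
    by (simp add: sum.distrib)
  finally show ?thesis using 1 2 by simp
qed

text \<open>Truncated subtraction on naturals gives the value 0 from \<open>2 * r\<close> on. The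
  numerator is a natural number, so values move in steps of \<open>1 / real r\<close>.\<close>

definition cutoff :: "nat \<Rightarrow> nat \<Rightarrow> real" where
  "cutoff r n = real (min r (2 * r - n)) / real r"

lemma cutoff_range: "0 \<le> cutoff r n" "cutoff r n \<le> 1"
  by (auto simp: cutoff_def divide_le_eq)

lemma cutoff_eq_1: "0 < r \<Longrightarrow> n \<le> r \<Longrightarrow> cutoff r n = 1"
  by (simp add: cutoff_def min_def)

lemma cutoff_eq_0: "2 * r \<le> n \<Longrightarrow> cutoff r n = 0"
  by (simp add: cutoff_def)

text \<open>One edge lowers the numerator by at most one, so a drop goes from \<open>Suc k\<close>
  to \<open>k\<close>; either \<open>k = 0\<close> or \<open>Suc k \<le> 2 * k\<close>. This
  supplies the hypothesis \<open>drop\<close> of \<open>edge_estimate\<close>.\<close>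

lemma cutoff_drop:
  assumes "cutoff r n' < cutoff r n" "n' \<le> Suc n" "0 < r"
  shows "r \<le> n" "cutoff r n - cutoff r n' = 1 / real r"
    "cutoff r n' = 0 \<or> cutoff r n \<le> 2 * cutoff r n'"
proof -
  have less: "min r (2 * r - n') < min r (2 * r - n)"
    using assms by (simp add: cutoff_def divide_less_cancel)
  then show "r \<le> n" using assms by auto
  have eq: "min r (2 * r - n) = Suc (min r (2 * r - n'))" using less assms by auto
  then show "cutoff r n - cutoff r n' = 1 / real r"
    by (simp add: cutoff_def diff_divide_distrib[symmetric])
  show "cutoff r n' = 0 \<or> cutoff r n \<le> 2 * cutoff r n'"
    unfolding cutoff_def eq using assms(3)
    by (cases "min r (2 * r - n')") (auto simp: field_simps)
qed

definition mass :: "('v \<Rightarrow> 'v \<Rightarrow> real) \<Rightarrow> real \<Rightarrow> ('v \<Rightarrow> real) \<Rightarrow> 'v set \<Rightarrow> real" where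
  "mass w q u A = (\<Sum>x\<in>A. vmeas w x * u x powr q)"

section \<open>Growth of the mass\<close>

text \<open>Green's formula moves the tested inequality to edges, \<open>edge_estimate\<close>
  charges each edge to its endpoint with the larger \<open>u\<close>, and interpolation turns the
  charges into volume and mass. Charges occur only at distance at least \<open>r\<close>, hence the
  radius \<open>r - 1\<close>.\<close>

lemma mass_estimate:
  fixes w :: "'v \<Rightarrow> 'v \<Rightarrow> real" and u :: "'v \<Rightarrow> real" and x0 :: 'v and p r :: nat
  assumes wg: "weighted_graph w" and conn: "connected_graph w" and lf: "locally_finite w"
    and u0: "\<And>x. 0 \<le> u x" and super: "\<And>x. u x powr q \<le> - laplacian w u x"
    and t: "0 < t" "1 + t < q" "real (p + 2) * (1 + t) \<le> real p * q"
    and r: "0 < r" and \<rho>: "0 < \<rho>"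
  defines "\<phi> \<equiv> \<lambda>x. cutoff r (gdist w x0 x)"
  defines "N \<equiv> \<Sum>x\<in>gball w x0 (2 * r). vmeas w x * u x powr q * \<phi> x ^ (p + 2)"
  shows "N \<le> \<rho> * (edge_const p t * 2 powr (1 + t) / (real r)\<^sup>2)
    * (set_meas w (gball w x0 (2 * r)) + \<rho> powr (- q) * (N - mass w q u (gball w x0 (r - 1))))"
proof -
  define S where "S = gball w x0 (2 * r)"
  define A where "A = {x\<in>S. r \<le> gdist w x0 x}"
  define v where "v = (\<lambda>x. u x / \<rho>)"
  define \<psi> where "\<psi> = (\<lambda>x. \<phi> x ^ (p + 2) * damp t (v x))"
  define K where "K = edge_const p t"
  \<comment> \<open>The charge at \<open>x\<close>; the squared drop of the cutoff has become
    \<open>1 / r^2\<close>.\<close>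
  define G where "G = (\<lambda>x. if r \<le> gdist w x0 x
    then K / (real r)\<^sup>2 * \<phi> x ^ p * (1 + v x) powr (1 + t) else 0)"
  have finS: "finite S" unfolding S_def using finite_gball conn lf .
  have v0: "0 \<le> v x" for x using u0 \<rho> by (simp add: v_def)
  have \<phi>: "0 \<le> \<phi> x" "\<phi> x \<le> 1" for x unfolding \<phi>_def by (rule cutoff_range)+
  have K0: "0 < K" unfolding K_def using t by (simp add: edge_const_pos)
  have G0: "0 \<le> G x" for x using K0 \<phi> by (simp add: G_def)
  have vm: "0 \<le> vmeas w x" for x using wg by (rule vmeas_nonneg)
  have adjsym: "adj w x y \<Longrightarrow> adj w y x" for x y using wg by (simp add: adj_def weighted_graph_def)

  have edge: "(v x - v y) * (\<psi> x - \<psi> y) \<le> G x" if xy: "adj w x y" and le: "v y \<le> v x" for x y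
  proof -
    have d: "gdist w x0 y \<le> Suc (gdist w x0 x)" using gdist_adj_le conn xy .
    have "(v x - v y) * (\<psi> x - \<psi> y)
      \<le> (if \<phi> y < \<phi> x then K * (\<phi> x - \<phi> y)\<^sup>2 * \<phi> x ^ p * (1 + v x) powr (1 + t) else 0)"
      unfolding \<psi>_def K_def
      by (rule edge_estimate) (use v0 le t \<phi> cutoff_drop(3)[OF _ d r] in \<open>auto simp: \<phi>_def\<close>)
    also have "\<dots> \<le> G x"
    proof (cases "\<phi> y < \<phi> x")
      case True
      note cd = cutoff_drop[OF True[unfolded \<phi>_def] d r]
      show ?thesis using True cd(1,2) by (simp add: G_def \<phi>_def power_divide)
    next
      case False
      then show ?thesis using G0 by simp
    qed
    finally show ?thesis .
  qed
  \<comment> \<open>Adding both charges removes the orientation of the edge, as the sum over ordered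
    pairs requires.\<close>
  have edge2: "(v x - v y) * (\<psi> x - \<psi> y) \<le> G x + G y" if "adj w x y" for x y
  proof (cases "v y \<le> v x")
    case True
    with edge[OF that] G0[of y] show ?thesis by simp
  next
    case False
    with edge[OF adjsym[OF that]] G0[of x] have "(v y - v x) * (\<psi> y - \<psi> x) \<le> G x + G y" by simp
    then show ?thesis by (simp add: algebra_simps)
  qed

  have "N \<le> (\<Sum>x\<in>S. \<psi> x * (\<Sum>y\<in>S. w x y * (u x - u y)))"
    unfolding N_def S_def[symmetric]
  proof (rule sum_mono)
    fix x assume "x \<in> S"
    show "vmeas w x * u x powr q * \<phi> x ^ (p + 2) \<le> \<psi> x * (\<Sum>y\<in>S. w x y * (u x - u y))"
    \<comment> \<open>Only on the sphere of radius \<open>2 * r\<close> can neighbours leave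
      \<open>S\<close>, and there the cutoff is 0.\<close>
    proof (cases "gdist w x0 x < 2 * r")
      case False
      then have "\<phi> x = 0" by (simp add: \<phi>_def cutoff_eq_0)
      then show ?thesis by (simp add: \<psi>_def)
    next
      case True
      have "{y. adj w x y} \<subseteq> S"
        using gdist_adj_le[OF conn, of x _ x0] True by (force simp: S_def gball_def)
      then have *: "vmeas w x * - laplacian w u x = (\<Sum>y\<in>S. w x y * (u x - u y))"
        by (rule vmeas_mult_laplacian[OF wg lf finS])
      have "vmeas w x * u x powr q * \<phi> x ^ (p + 2)
        \<le> (vmeas w x * - laplacian w u x) * (\<phi> x ^ (p + 2) * damp t (v x))"
      proof (rule mult_mono)
        show "vmeas w x * u x powr q \<le> vmeas w x * - laplacian w u x"
          using super vm by (rule mult_left_mono)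
        then show "0 \<le> vmeas w x * - laplacian w u x"
          using vm[of x] by (smt (verit) mult_nonneg_nonneg powr_ge_zero)
        show "\<phi> x ^ (p + 2) \<le> \<phi> x ^ (p + 2) * damp t (v x)"
          using mult_left_mono[OF damp_bounds(1)[OF v0 t(1)], of "\<phi> x ^ (p + 2)" x] \<phi>(1)[of x] by simp
        show "0 \<le> \<phi> x ^ (p + 2)" using \<phi>(1)[of x] by simp
      qed
      then show ?thesis unfolding * by (simp add: \<psi>_def mult_ac)
    qed
  qed
  then have "2 * N \<le> (\<Sum>x\<in>S. \<Sum>y\<in>S. w x y * ((u x - u y) * (\<psi> x - \<psi> y)))"
    using green_formula[OF wg, where S = S and \<psi> = \<psi> and u = u] by simp
  also have "\<dots> \<le> (\<Sum>x\<in>S. \<Sum>y\<in>S. w x y * (\<rho> * (G x + G y)))"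
  proof (intro sum_mono)
    fix x y
    have eq: "(u x - u y) * (\<psi> x - \<psi> y) = \<rho> * ((v x - v y) * (\<psi> x - \<psi> y))"
      using \<rho> by (simp add: v_def field_simps)
    show "w x y * ((u x - u y) * (\<psi> x - \<psi> y)) \<le> w x y * (\<rho> * (G x + G y))"
    proof (cases "adj w x y")
      case True
      then show ?thesis unfolding eq using edge2[OF True] \<rho>
        by (intro mult_left_mono) (auto simp: adj_def)
    next
      case False
      then have "w x y = 0" using wg by (auto simp: adj_def weighted_graph_def order.antisym not_less)
      then show ?thesis by simp
    qed
  qed
  also have "\<dots> = 2 * (\<Sum>x\<in>S. \<rho> * G x * (\<Sum>y\<in>S. w x y))"
  proof -
    have sym: "w x y = w y x" for x y using wg by (simp add: weighted_graph_def)
    have "(\<Sum>x\<in>S. \<Sum>y\<in>S. w x y * (\<rho> * G y)) = (\<Sum>x\<in>S. \<Sum>y\<in>S. w x y * (\<rho> * G x))"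
      by (subst sum.swap) (simp add: sym)
    then have "(\<Sum>x\<in>S. \<Sum>y\<in>S. w x y * (\<rho> * (G x + G y))) = 2 * (\<Sum>x\<in>S. \<Sum>y\<in>S. w x y * (\<rho> * G x))"
      by (simp add: distrib_left sum.distrib)
    then show ?thesis by (simp add: sum_distrib_left mult_ac)
  qed
  finally have "N \<le> (\<Sum>x\<in>S. \<rho> * G x * (\<Sum>y\<in>S. w x y))" by simp
  also have "\<dots> \<le> (\<Sum>x\<in>S. \<rho> * G x * vmeas w x)"
    using sum_weight_le_vmeas[OF wg lf finS] G0 \<rho> by (intro sum_mono mult_left_mono) auto
  also have "\<dots> = (\<Sum>x\<in>A. \<rho> * G x * vmeas w x)"
    unfolding A_def using finS by (intro sum.mono_neutral_right) (auto simp: G_def)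
  also have "\<dots> \<le> (\<Sum>x\<in>A. \<rho> * (K * 2 powr (1 + t) / (real r)\<^sup>2)
      * (vmeas w x + \<rho> powr (- q) * (vmeas w x * u x powr q * \<phi> x ^ (p + 2))))"
  proof (rule sum_mono)
    fix x assume "x \<in> A"
    then have "G x = K / (real r)\<^sup>2 * (\<phi> x ^ p * (1 + v x) powr (1 + t))"
      by (simp add: G_def A_def)
    also have "\<dots> \<le> K / (real r)\<^sup>2 * (2 powr (1 + t) * (1 + \<phi> x ^ (p + 2) * v x powr q))"
      using K0 \<phi> v0 t by (intro mult_left_mono weighted_interpolation) auto
    finally have "\<rho> * G x * vmeas w x
      \<le> \<rho> * (K / (real r)\<^sup>2 * (2 powr (1 + t) * (1 + \<phi> x ^ (p + 2) * v x powr q))) * vmeas w x"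
      using \<rho> vm by (intro mult_right_mono mult_left_mono) auto
    also have "v x powr q = \<rho> powr (- q) * u x powr q"
      using u0 \<rho> by (simp add: v_def powr_divide powr_minus_divide)
    finally show "\<rho> * G x * vmeas w x \<le> \<rho> * (K * 2 powr (1 + t) / (real r)\<^sup>2)
      * (vmeas w x + \<rho> powr (- q) * (vmeas w x * u x powr q * \<phi> x ^ (p + 2)))"
      by (simp add: algebra_simps)
  qed
  also have "\<dots> = \<rho> * (K * 2 powr (1 + t) / (real r)\<^sup>2)
      * (set_meas w A + \<rho> powr (- q) * (\<Sum>x\<in>A. vmeas w x * u x powr q * \<phi> x ^ (p + 2)))"
    by (simp only: sum_distrib_left[symmetric] sum.distrib set_meas_def)
  also have "(\<Sum>x\<in>A. vmeas w x * u x powr q * \<phi> x ^ (p + 2)) = N - mass w q u (gball w x0 (r - 1))"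
  proof -
    have sub: "gball w x0 (r - 1) \<subseteq> S" by (auto simp: S_def gball_def)
    have A: "A = S - gball w x0 (r - 1)" using r by (auto simp: A_def gball_def)
    have "\<phi> x = 1" if "x \<in> gball w x0 (r - 1)" for x
      using that r by (auto simp: \<phi>_def gball_def intro!: cutoff_eq_1)
    then show ?thesis
      unfolding A sum_diff[OF finS sub] N_def S_def[symmetric] mass_def by simp
  qed
  \<comment> \<open>Only the volume is enlarged to the whole ball; the mass term stays a difference,
    as the later telescoping needs.\<close>
  also have "\<rho> * (K * 2 powr (1 + t) / (real r)\<^sup>2)
      * (set_meas w A + \<rho> powr (- q) * (N - mass w q u (gball w x0 (r - 1))))
    \<le> \<rho> * (K * 2 powr (1 + t) / (real r)\<^sup>2)
      * (set_meas w S + \<rho> powr (- q) * (N - mass w q u (gball w x0 (r - 1))))"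
    using \<rho> K0 by (intro mult_left_mono add_right_mono set_meas_mono wg finS) (auto simp: A_def)
  finally show ?thesis unfolding S_def K_def .
qed

lemma mass_mono:
  assumes "weighted_graph w" "finite B" "A \<subseteq> B"
  shows "mass w q u A \<le> mass w q u B"
  unfolding mass_def using assms vmeas_nonneg[OF assms(1)] by (intro sum_mono2) auto

text \<open>The cutoff mass \<open>N\<close> lies between the masses of the two balls, the outer
  radius being \<open>2 * r - 1\<close> because the cutoff vanishes at distance
  \<open>2 * r\<close>. Doubling \<open>r\<close> sends \<open>r - 1\<close> to
  \<open>2 * r - 1\<close>, so these bounds telescope exactly.\<close>

lemma mass_decay:
  fixes w :: "'v \<Rightarrow> 'v \<Rightarrow> real" and u :: "'v \<Rightarrow> real" and x0 :: 'v
  assumes wg: "weighted_graph w" and conn: "connected_graph w" and lf: "locally_finite w"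
    and u0: "\<And>x. 0 \<le> u x" and super: "\<And>x. u x powr q \<le> - laplacian w u x"
    and q: "1 < q"
  obtains C where "0 < C"
    "\<And>r. \<lbrakk>0 < r; 0 < mass w q u (gball w x0 (r - 1)); 0 < set_meas w (gball w x0 (2 * r))\<rbrakk> \<Longrightarrow>
      ((real r)\<^sup>2 / C) powr q * set_meas w (gball w x0 (2 * r)) powr (1 - q)
      \<le> (mass w q u (gball w x0 (r - 1)) powr (1 - q)
          - mass w q u (gball w x0 (2 * r - 1)) powr (1 - q)) / (q - 1)"
proof -
  \<comment> \<open>This puts \<open>1 + t\<close> midway between 1 and \<open>q\<close>.\<close>
  define t where "t = (q - 1) / 2"
  have t: "0 < t" "1 + t < q" using q by (auto simp: t_def field_simps)
  \<comment> \<open>The exponent condition of \<open>weighted_interpolation\<close>, solved for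
    \<open>p\<close>.\<close>
  obtain p :: nat where p: "2 * (1 + t) / (q - (1 + t)) \<le> real p" using real_arch_simple by blast
  then have pt: "real (p + 2) * (1 + t) \<le> real p * q"
    using t by (simp add: field_simps)
  define C where "C = edge_const p t * 2 powr (1 + t)"
  have C: "0 < C" using t by (simp add: C_def edge_const_pos)
  show thesis
  proof (rule that[of "2 * C"])
    show "0 < 2 * C" using C by simp
    fix r :: nat
    define M where "M = mass w q u (gball w x0 (r - 1))"
    define M' where "M' = mass w q u (gball w x0 (2 * r - 1))"
    define V where "V = set_meas w (gball w x0 (2 * r))"
    define \<phi> where "\<phi> = (\<lambda>x. cutoff r (gdist w x0 x))"
    define N where "N = (\<Sum>x\<in>gball w x0 (2 * r). vmeas w x * u x powr q * \<phi> x ^ (p + 2))"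
    assume r: "0 < r" and "0 < mass w q u (gball w x0 (r - 1))"
      and "0 < set_meas w (gball w x0 (2 * r))"
    then have pos: "0 < M" "0 < V" by (simp_all add: M_def V_def)
    have fin: "finite (gball w x0 n)" for n by (rule finite_gball[OF conn lf])
    have vm: "0 \<le> vmeas w x" for x using wg by (rule vmeas_nonneg)
    have \<phi>: "0 \<le> \<phi> x" "\<phi> x \<le> 1" for x unfolding \<phi>_def by (rule cutoff_range)+
    have MN: "M \<le> N"
    proof -
      have "\<phi> x = 1" if "x \<in> gball w x0 (r - 1)" for x
        using that r by (auto simp: \<phi>_def gball_def intro!: cutoff_eq_1)
      then have "M = (\<Sum>x\<in>gball w x0 (r - 1). vmeas w x * u x powr q * \<phi> x ^ (p + 2))"
        by (simp add: M_def mass_def)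
      also have "\<dots> \<le> N" unfolding N_def using fin vm \<phi>
        by (intro sum_mono2) (auto simp: gball_def)
      finally show ?thesis .
    qed
    have NM: "N \<le> M'"
    proof -
      have "N = (\<Sum>x\<in>gball w x0 (2 * r - 1). vmeas w x * u x powr q * \<phi> x ^ (p + 2))"
        unfolding N_def using fin
        by (intro sum.mono_neutral_right) (auto simp: gball_def \<phi>_def intro!: cutoff_eq_0)
      also have "\<dots> \<le> M'" unfolding M'_def mass_def
        using vm \<phi> by (intro sum_mono mult_left_le power_le_one) auto
      finally show ?thesis .
    qed
    have "((real r)\<^sup>2 / (2 * C)) powr q * V powr (1 - q) \<le> (M powr (1 - q) - N powr (1 - q)) / (q - 1)"
    proof (rule optimise_scale)
      fix \<rho> :: real assume "0 < \<rho>"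
      from mass_estimate[OF wg conn lf u0 super t pt r this, of x0]
      show "N \<le> \<rho> * (C / (real r)\<^sup>2) * (V + \<rho> powr (- q) * (N - M))"
        by (simp only: N_def V_def M_def C_def \<phi>_def)
    qed (use pos MN r C q in auto)
    also have "\<dots> \<le> (M powr (1 - q) - M' powr (1 - q)) / (q - 1)"
    proof -
      have "M' powr (1 - q) \<le> N powr (1 - q)"
        using NM MN pos q by (intro powr_mono2') auto
      then show ?thesis using q by (simp add: divide_right_mono)
    qed
    finally show "((real r)\<^sup>2 / (2 * C)) powr q * set_meas w (gball w x0 (2 * r)) powr (1 - q)
      \<le> (mass w q u (gball w x0 (r - 1)) powr (1 - q)
          - mass w q u (gball w x0 (2 * r - 1)) powr (1 - q)) / (q - 1)"
      by (simp add: M_def M'_def V_def)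
  qed
qed

section \<open>Dyadic summation and the Liouville theorem\<close>

text \<open>The block has \<open>2 * r\<close> terms, each at most its numerator at
  \<open>4 * r\<close> over its denominator at \<open>2 * r\<close>. The number of terms raises the
  exponent \<open>2 * q - 1\<close> to \<open>2 * q\<close>, matching
  \<open>(r^2) powr q\<close>.\<close>

lemma dyadic_block:
  fixes V :: "nat \<Rightarrow> real" and r :: nat
  assumes "0 < r" "0 < V (2 * r)" "\<And>n. 2 * r \<le> n \<Longrightarrow> V (2 * r) \<le> V n" "1 < q" "0 < C"
  shows "(\<Sum>n\<in>{2 * r..<4 * r}. real n powr (2 * q - 1) / V n powr (q - 1))
    \<le> 2 * 4 powr (2 * q - 1) * C powr q * (((real r)\<^sup>2 / C) powr q * V (2 * r) powr (1 - q))"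
proof -
  have "real n powr (2 * q - 1) / V n powr (q - 1)
      \<le> (4 * real r) powr (2 * q - 1) / V (2 * r) powr (q - 1)" if "n \<in> {2 * r..<4 * r}" for n
    using that assms by (intro frac_le powr_mono2) auto
  from sum_bounded_above[where A = "{2 * r..<4 * r}", OF this]
  have "(\<Sum>n\<in>{2 * r..<4 * r}. real n powr (2 * q - 1) / V n powr (q - 1))
      \<le> real (2 * r) * ((4 * real r) powr (2 * q - 1) / V (2 * r) powr (q - 1))"
    by simp
  also have "\<dots> = 2 * 4 powr (2 * q - 1) * (real r * real r powr (2 * q - 1)) * V (2 * r) powr (1 - q)"
    by (simp add: powr_mult powr_minus_divide[of _ "q - 1", simplified])
  also have "real r * real r powr (2 * q - 1) = (real r)\<^sup>2 powr q"
    using assms(1) by (simp add: powr_mult_base powr_powr flip: powr_numeral)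
  also have "\<dots> = C powr q * ((real r)\<^sup>2 / C) powr q"
    using assms by (simp add: powr_divide)
  finally show ?thesis by (simp add: mult_ac)
qed

theorem theorem1p2:
  fixes w :: "'v \<Rightarrow> 'v \<Rightarrow> real" and q :: real and x0 :: 'v and u :: "'v \<Rightarrow> real"
  assumes "weighted_graph w"
    and "infinite (UNIV :: 'v set)"
    and "connected_graph w"
    and "locally_finite w"
    and "q > 1"
    and "\<not> summable (\<lambda>n::nat. real (n + 1) powr (2 * q - 1)
                                 / set_meas w (gball w x0 (n + 1)) powr (q - 1))"
    and "\<forall>x. u x \<ge> 0"
    and "\<forall>x. - laplacian w u x \<ge> u x powr q"
  shows "\<forall>x. u x = 0"
proof (rule ccontr)
  assume "\<not> (\<forall>x. u x = 0)"
  with assms(7) obtain x1 where x1: "0 < u x1" by (metis order_le_less)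
  have "vmeas w x1 \<noteq> 0"
  proof
    assume "vmeas w x1 = 0"
    \<comment> \<open>Division by zero yields 0, so the Laplacian vanishes here and the inequality
      contradicts \<open>0 < u x1\<close>.\<close>
    then have "laplacian w u x1 = 0" by (simp add: laplacian_def)
    with assms(8) have "u x1 powr q \<le> 0" by (metis neg_equal_zero)
    with x1 show False by simp
  qed
  with vmeas_nonneg[OF assms(1)] have v1: "0 < vmeas w x1" by (metis order_le_less)
  define V where "V = (\<lambda>n. set_meas w (gball w x0 n))"
  define T where "T = (\<lambda>n. real n powr (2 * q - 1) / V n powr (q - 1))"
  define M where "M = (\<lambda>n. mass w q u (gball w x0 n))"
  \<comment> \<open>From this radius on the balls contain \<open>x1\<close>, so volume and mass are
    positive.\<close>
  define j where "j = gdist w x0 x1"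
  define F where "F = (\<lambda>k::nat. M (2 ^ k - 1) powr (1 - q))"
  have fin: "finite (gball w x0 n)" for n by (rule finite_gball[OF assms(3,4)])
  have Vmono: "V m \<le> V n" if "m \<le> n" for m n
    unfolding V_def using that by (intro set_meas_mono assms(1) fin) (auto simp: gball_def)
  have inball: "{x1} \<subseteq> gball w x0 n" if "j \<le> n" for n
    using that by (simp add: gball_def j_def)
  have Vpos: "0 < V n" if "j \<le> n" for n
    using set_meas_mono[OF assms(1) fin inball[OF that]] v1 by (simp add: V_def set_meas_def)
  have Mpos: "0 < M n" if "j \<le> n" for n
    using mass_mono[OF assms(1) fin inball[OF that], of q u] v1 x1
    by (simp add: M_def mass_def) (smt (verit) mult_pos_pos powr_gt_zero)
  obtain C where C: "0 < C" and decay: "\<And>r. \<lbrakk>0 < r; 0 < M (r - 1); 0 < V (2 * r)\<rbrakk> \<Longrightarrow>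
      ((real r)\<^sup>2 / C) powr q * V (2 * r) powr (1 - q)
      \<le> (M (r - 1) powr (1 - q) - M (2 * r - 1) powr (1 - q)) / (q - 1)"
    using mass_decay[OF assms(1,3,4) assms(7)[rule_format] assms(8)[rule_format] assms(5), of x0]
    unfolding M_def V_def by metis
  define D where "D = 2 * 4 powr (2 * q - 1) * C powr q / (q - 1)"
  have D: "0 \<le> D" using assms(5) by (simp add: D_def)
  have block: "(\<Sum>n\<in>{2 ^ Suc k..<2 ^ Suc (Suc k)}. T n) \<le> D * (F k - F (Suc k))" if "j \<le> k" for k
  proof -
    define r :: nat where "r = 2 ^ k"
    \<comment> \<open>Ensures that even the smaller ball, of radius \<open>2 ^ k - 1\<close>,
      contains \<open>x1\<close>.\<close>
    have "k < r" by (simp add: r_def)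
    then have r: "0 < r" "j \<le> r - 1" "j \<le> 2 * r" using that by auto
    have "(\<Sum>n\<in>{2 ^ Suc k..<2 ^ Suc (Suc k)}. T n) = (\<Sum>n\<in>{2 * r..<4 * r}. T n)"
      by (simp add: r_def)
    also have "\<dots> \<le> 2 * 4 powr (2 * q - 1) * C powr q * (((real r)\<^sup>2 / C) powr q * V (2 * r) powr (1 - q))"
      unfolding T_def using r Vpos Vmono assms(5) C by (intro dyadic_block) auto
    also have "\<dots> \<le> 2 * 4 powr (2 * q - 1) * C powr q
        * ((M (r - 1) powr (1 - q) - M (2 * r - 1) powr (1 - q)) / (q - 1))"
      using decay r Vpos Mpos by (intro mult_left_mono) auto
    also have "\<dots> = D * (F k - F (Suc k))"
      by (simp add: D_def F_def r_def)
    finally show ?thesis .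
  qed
  have partial: "(\<Sum>n\<in>{2 ^ Suc j..<2 ^ Suc (j + i)}. T n) \<le> D * (F j - F (j + i))" for i
  proof (induction i)
    case (Suc i)
    have "(\<Sum>n\<in>{2 ^ Suc j..<2 ^ Suc (j + Suc i)}. T n)
      = (\<Sum>n\<in>{2 ^ Suc j..<2 ^ Suc (j + i)}. T n) + (\<Sum>n\<in>{2 ^ Suc (j + i)..<2 ^ Suc (Suc (j + i))}. T n)"
      by (subst sum.atLeastLessThan_concat) auto
    also have "\<dots> \<le> D * (F j - F (j + i)) + D * (F (j + i) - F (Suc (j + i)))"
      using Suc block[of "j + i"] by (intro add_mono) auto
    finally show ?case by (simp add: algebra_simps)
  qed simp
  have T0: "0 \<le> T n" for n by (simp add: T_def)
  have "summable (\<lambda>n. T (n + 2 ^ Suc j))"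
  proof (rule summableI_nonneg_bounded)
    fix i
    \<comment> \<open>Every partial sum fits into a union of dyadic blocks, so
      \<open>partial\<close> bounds it uniformly in \<open>i\<close>.\<close>
    have "i + 2 ^ Suc j \<le> (2::nat) ^ Suc (j + i)"
    proof -
      have "i + 1 \<le> (2::nat) ^ i" by (simp add: Suc_le_eq)
      have "i + 2 ^ Suc j \<le> 2 ^ Suc j * (i + 1)" by simp
      also have "\<dots> \<le> 2 ^ Suc j * 2 ^ i" using \<open>i + 1 \<le> 2 ^ i\<close> by (rule mult_left_mono) simp
      also have "\<dots> = 2 ^ Suc (j + i)" by (simp add: power_add)
      finally show ?thesis .
    qed
    then have "sum T {2 ^ Suc j..<i + 2 ^ Suc j} \<le> (\<Sum>n\<in>{2 ^ Suc j..<2 ^ Suc (j + i)}. T n)"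
      using T0 by (intro sum_mono2) auto
    then have "(\<Sum>n<i. T (n + 2 ^ Suc j)) \<le> (\<Sum>n\<in>{2 ^ Suc j..<2 ^ Suc (j + i)}. T n)"
      using sum.shift_bounds_nat_ivl[of T 0 "2 ^ Suc j" i] by (simp only: lessThan_atLeast0 add_0)
    also have "\<dots> \<le> D * (F j - F (j + i))" by (rule partial)
    also have "\<dots> \<le> D * F j" using D by (intro mult_left_mono) (auto simp: F_def)
    finally show "(\<Sum>n<i. T (n + 2 ^ Suc j)) \<le> D * F j" .
  qed (rule T0)
  \<comment> \<open>Discarding finitely many terms does not affect summability; the shift by 1
    matches the indexing of the hypothesis.\<close>
  then have "summable (\<lambda>n. T (n + 1))" by (simp only: summable_iff_shift)
  with assms(6) show False by (simp add: T_def V_def)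
qed

end
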